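(* Let $a,b$ be integers with $3\le a\le b$, and define $$\rho(a,b)=\begin{cases}2a-1,&a=b\text{ and }a\text{ is odd},\\ 2a,&a=b\text{ and }a\text{ is even},\\ \min\{b,2a\},&a<b\text{ and }a\text{ is odd},\\ a,&a<b,\ a\text{ is even, and }b\text{ is odd},\\ 2a,&a<b\text{ and }a,b\text{ are even}.\end{cases}$$ Then $$Z_-(C_a\square C_b)=\rho(a,b)\qquad\text{and}\qquad\gamma_{\mathrm{gr}}^t(C_a\square C_b)=ab-\rho(a,b).$$
   Context: All graphs are finite and simple. $C_n$ is the cycle on $n$ vertices. The Cartesian product $G\square H$ has vertex set $V(G)\times V(H)$, with $(u,x)$ adjacent to $(v,y)$ iff either $u=v$ and $xy\in E(H)$, or $x=y$ and $uv\in E(G)$. $N_G(v)$ denotes the open neighborhood of $v$. Skew zero forcing: vertices are colored blue or white. If a vertex $u$ of either color has exactly one white neighbor $v$, then $u$ may force $v$, i.e. $v$ becomes blue. A set $B\subseteq V(G)$ is a skew zero forcing set if, starting with exactly the vertices of $B$ blue, repeated legal forces can color all vertices blue. $Z_-(G)$ is the minimum cardinality of a skew zero forcing set. Grundy total domination: for $G$ without isolated vertices, a sequence $(v_1,\ldots,v_k)$ of distinct vertices is a legal open-neighborhood sequence if $N_G(v_i)\setminus\bigcup_{j=1}^{i-1}N_G(v_j)\neq\varnothing$ for every $1\le i\le k$. $\gamma_{\mathrm{gr}}^t(G)$ is the maximum length of a legal open-neighborhood sequence. *)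

theory Defs
  imports Main "Graph_Theory.Pair_Digraph"
begin

text \<open>
  A finite simple graph is a value of type \<^typ>\<open>'a pair_pre_digraph\<close> satisfying
  \<^const>\<open>pair_graph\<close>: each edge \<open>uv\<close> is represented by the two arcs \<open>(u, v)\<close> and \<open>(v, u)\<close>.
\<close>

definition nbh :: "'a pair_pre_digraph \<Rightarrow> 'a \<Rightarrow> 'a set" where
  "nbh G v = {w. (v, w) \<in> parcs G}"

text \<open>The vertex set of \<open>cycle_graph n\<close> is \<open>{0..<n}\<close>; it is a simple cycle for \<open>n \<ge> 3\<close>.\<close>

definition cycle_graph :: "nat \<Rightarrow> nat pair_pre_digraph" where
  "cycle_graph n =
    \<lparr> pverts = {0..<n},
      parcs = {(i, j). i < n \<and> j < n \<and> (j = (i + 1) mod n \<or> i = (j + 1) mod n)} \<rparr>"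

definition cart_prod ::
    "'a pair_pre_digraph \<Rightarrow> 'b pair_pre_digraph \<Rightarrow> ('a \<times> 'b) pair_pre_digraph"
    (infixl "\<box>" 70) where
  "G \<box> H =
    \<lparr> pverts = pverts G \<times> pverts H,
      parcs = {((u, x), (v, y)). (u, x) \<in> pverts G \<times> pverts H \<and> (v, y) \<in> pverts G \<times> pverts H \<and>
                 (u = v \<and> (x, y) \<in> parcs H \<or> x = y \<and> (u, v) \<in> parcs G)} \<rparr>"


text \<open>
  \<open>skew_force G B B'\<close>: with exactly the vertices of \<open>B\<close> blue, some vertex \<open>u\<close> of either colour
  (so \<open>u \<in> B\<close> is not required) forces its unique white neighbour \<open>v\<close>, giving the blue set \<open>B'\<close>.
\<close>

definition skew_force :: "'a pair_pre_digraph \<Rightarrow> 'a set \<Rightarrow> 'a set \<Rightarrow> bool" where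
  "skew_force G B B' \<longleftrightarrow>
    (\<exists>u \<in> pverts G. \<exists>v \<in> pverts G. nbh G u - B = {v} \<and> B' = insert v B)"

definition skew_zero_forcing_set :: "'a pair_pre_digraph \<Rightarrow> 'a set \<Rightarrow> bool" where
  "skew_zero_forcing_set G B \<longleftrightarrow> B \<subseteq> pverts G \<and> (skew_force G)\<^sup>*\<^sup>* B (pverts G)"

definition skew_zero_forcing_number :: "'a pair_pre_digraph \<Rightarrow> nat" where
  "skew_zero_forcing_number G = Min (card ` {B. skew_zero_forcing_set G B})"


definition legal_open_nbh_seq :: "'a pair_pre_digraph \<Rightarrow> 'a list \<Rightarrow> bool" where
  "legal_open_nbh_seq G vs \<longleftrightarrow>
    set vs \<subseteq> pverts G \<and> distinct vs \<and>
    (\<forall>i < length vs. nbh G (vs ! i) - (\<Union>j<i. nbh G (vs ! j)) \<noteq> {})"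

text \<open>Intended for graphs without isolated vertices.\<close>

definition grundy_total_domination_number :: "'a pair_pre_digraph \<Rightarrow> nat" where
  "grundy_total_domination_number G = Max (length ` {vs. legal_open_nbh_seq G vs})"


text \<open>
  Only meant for \<open>3 \<le> a \<le> b\<close>. In that range neither \<open>2 * a - 1\<close> nor \<open>a * b - rho a b\<close> is affected
  by truncated subtraction (see \<open>rho_le\<close> below for the latter).
\<close>

definition rho :: "nat \<Rightarrow> nat \<Rightarrow> nat" where
  "rho a b =
    (if a = b then (if odd a then 2 * a - 1 else 2 * a)
     else if odd a then min b (2 * a)
     else if odd b then a
     else 2 * a)"

lemma rho_le:
  assumes "3 \<le> a" "a \<le> b"
  shows "rho a b \<le> a * b"
proof -
  have "rho a b \<le> a * 2"
    by (auto simp: rho_def)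
  also have "\<dots> \<le> a * b"
    using assms by (intro mult_le_mono) auto
  finally show ?thesis .
qed


text \<open>Both parameters are minima and maxima of finite nonempty sets.\<close>

lemma skew_zero_forcing_sets_wf:
  assumes "finite (pverts G)"
  shows "finite {B. skew_zero_forcing_set G B}" "skew_zero_forcing_set G (pverts G)"
  using assms by (auto simp: skew_zero_forcing_set_def intro: finite_subset[of _ "Pow (pverts G)"])

lemma legal_open_nbh_seqs_wf:
  assumes "finite (pverts G)"
  shows "finite {vs. legal_open_nbh_seq G vs}" "legal_open_nbh_seq G []"
proof -
  have "{vs. legal_open_nbh_seq G vs} \<subseteq> {vs. set vs \<subseteq> pverts G \<and> distinct vs}"
    by (auto simp: legal_open_nbh_seq_def)
  then show "finite {vs. legal_open_nbh_seq G vs}"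
    using finite_subset_distinct[OF assms] by (rule finite_subset)
qed (simp add: legal_open_nbh_seq_def)


lemma Suc_mod_neq_self:
  assumes "3 \<le> n"
  shows "Suc i mod n \<noteq> i"
proof
  assume eq: "Suc i mod n = i"
  then have "i < n"
    using assms by (metis mod_less_divisor not_numeral_le_zero zero_less_iff_neq_zero)
  then show False
    using eq assms by (cases "Suc i = n") auto
qed

lemma pair_graph_cycle_graph:
  assumes "3 \<le> n"
  shows "pair_graph (cycle_graph n)"
proof
  show "finite (parcs (cycle_graph n))"
    by (rule finite_subset[of _ "{0..<n} \<times> {0..<n}"]) (auto simp: cycle_graph_def)
  show "symmetric (with_proj (cycle_graph n))"
    by (auto simp: symmetric_def sym_def cycle_graph_def)
  show "fst e \<noteq> snd e" if "e \<in> parcs (cycle_graph n)" for e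
    using that Suc_mod_neq_self[OF assms, of "fst e"] by (auto simp: cycle_graph_def)
qed (auto simp: cycle_graph_def)

lemma pair_graph_cart_prod:
  assumes "pair_graph G" "pair_graph H"
  shows "pair_graph (G \<box> H)"
proof -
  interpret G: pair_graph G by fact
  interpret H: pair_graph H by fact
  have symG: "(v, u) \<in> parcs G" if "(u, v) \<in> parcs G" for u v
    using that G.pair_sym_arcs by (auto simp: symmetric_def dest: symD)
  have symH: "(v, u) \<in> parcs H" if "(u, v) \<in> parcs H" for u v
    using that H.pair_sym_arcs by (auto simp: symmetric_def dest: symD)
  show ?thesis
  proof
    show "finite (pverts (G \<box> H))"
      by (simp add: cart_prod_def G.pair_finite_verts H.pair_finite_verts)
    then show "finite (parcs (G \<box> H))"
      by (intro finite_subset[of "parcs (G \<box> H)" "pverts (G \<box> H) \<times> pverts (G \<box> H)"])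
        (auto simp: cart_prod_def)
    show "symmetric (with_proj (G \<box> H))"
      using symG symH by (auto simp: symmetric_def sym_def cart_prod_def)
    show "fst e \<noteq> snd e" if "e \<in> parcs (G \<box> H)" for e
      using that G.pair_no_loops H.pair_no_loops by (fastforce simp: cart_prod_def)
  qed (auto simp: cart_prod_def)
qed

lemma nbh_torus_nonempty:
  assumes "3 \<le> a" "3 \<le> b" "p \<in> pverts (cycle_graph a \<box> cycle_graph b)"
  shows "nbh (cycle_graph a \<box> cycle_graph b) p \<noteq> {}"
proof -
  obtain i j where p: "p = (i, j)" "i < a" "j < b"
    using assms(3) by (auto simp: cart_prod_def cycle_graph_def)
  then have "(i, (j + 1) mod b) \<in> nbh (cycle_graph a \<box> cycle_graph b) p"
    using assms by (auto simp: nbh_def cart_prod_def cycle_graph_def)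
  then show ?thesis by blast
qed

end

theory Submission
  imports Defs
begin

text \<open>
  The two invariants determine each other. The forcers of a skew zero forcing process, in the order in
  which they act, form a legal open-neighbourhood sequence, and all legal sequences arise in this way, so
  the two numbers add up to the number of vertices (\<open>grundy_total_domination_number_eq\<close>). It
  remains to determine the skew zero forcing number of the torus.

  For the lower bounds, let \<open>S\<close> be the blue set at some time and let its interior consist of the
  vertices all of whose neighbours are blue. Each force creates an interior vertex, so the
  difference between the size of \<open>S\<close> and the size of its interior never exceeds the number of
  initially blue vertices (\<open>skew_force_isoperimetric\<close>). This turns the problem into an
  isoperimetric one: a time has to be found at which this difference is large. Such a time is
  the one when two adjacent columns become full. A translation by one step embeds the interior
  into \<open>S\<close>; counting the points that it misses column by column or row by row shows that either
  all columns contribute, or some column is empty and each row contributes for each of the two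
  full columns (\<open>min_le_card_forcing_inter\<close>). If the columns have odd length \<open>m\<close>, this gives the
  bound \<open>min n (2 * m)\<close>. If both sides are even, the torus is bipartite, and the same argument
  inside each class gives \<open>min n m\<close> for each class.

  Only for a square of odd side is this too weak. There the vertices are the edges of a complete
  bipartite graph between diagonals and antidiagonals, the neighbourhoods are 4-cycles, and forcing
  preserves connected components; so the initially blue edges form a connected spanning subgraph
  on \<open>2 * a\<close> vertices (\<open>le_card_forcing_odd_square\<close>).

  The matching forcing sets are two adjacent columns, a closed zigzag or staircase that meets each
  row once, and, for the square of odd side, the union of a diagonal and an antidiagonal.
\<close>

section \<open>Forcing processes and legal sequences\<close>

text \<open>
  A forcing process without its order: it is enough to name, for each white vertex, a forcer
  whose other neighbours come earlier in some ranking. A white vertex of least rank can always be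
  forced next, so ties in the ranking are harmless.
\<close>
lemma skew_zero_forcing_set_if_rank:
  fixes rk :: "'a \<Rightarrow> nat"
  assumes fin: "finite (pverts G)" and BV: "B \<subseteq> pverts G"
    and forcer: "\<And>v. v \<in> pverts G - B \<Longrightarrow>
      \<exists>u \<in> pverts G. v \<in> nbh G u \<and> (\<forall>w \<in> nbh G u - {v}. w \<in> B \<or> w \<in> pverts G \<and> rk w < rk v)"
  shows "skew_zero_forcing_set G B"
proof -
  have "(skew_force G)\<^sup>*\<^sup>* S (pverts G)" if "B \<subseteq> S" "S \<subseteq> pverts G" for S
    using that
  proof (induction "card (pverts G - S)" arbitrary: S rule: less_induct)
    case less
    show ?case
    proof (cases "S = pverts G")
      case False
      then have "pverts G - S \<noteq> {}" using less.prems by auto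
      then obtain v where v: "v \<in> pverts G - S" "\<forall>w \<in> pverts G - S. rk v \<le> rk w"
        using ex_has_least_nat[of "\<lambda>v. v \<in> pverts G - S" _ rk] by blast
      then obtain u where u: "u \<in> pverts G" "v \<in> nbh G u"
          "\<forall>w \<in> nbh G u - {v}. w \<in> B \<or> w \<in> pverts G \<and> rk w < rk v"
        using forcer[of v] less.prems by blast
      have "nbh G u - S = {v}"
        using u v less.prems by (force simp: not_less[symmetric])
      then have step: "skew_force G S (insert v S)"
        using u(1) v(1) by (auto simp: skew_force_def)
      have "card (pverts G - insert v S) < card (pverts G - S)"
        using v(1) fin by (intro psubset_card_mono) auto
      then have "(skew_force G)\<^sup>*\<^sup>* (insert v S) (pverts G)"
        using less.hyps[of "insert v S"] less.prems v(1) by blast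
      with step show ?thesis by (rule converse_rtranclp_into_rtranclp)
    qed simp
  qed
  then show ?thesis using BV by (auto simp: skew_zero_forcing_set_def)
qed

text \<open>
  The forcers, listed in the order in which they act, form a legal sequence: all neighbours of the
  earlier forcers are blue when \<open>u\<close> forces \<open>v\<close>, so \<open>v\<close> is a neighbour of \<open>u\<close> that is new.
\<close>
lemma legal_seq_of_skew_forces:
  assumes fin: "finite (pverts G)" and BV: "B \<subseteq> pverts G"
    and "(skew_force G)\<^sup>*\<^sup>* B S"
  shows "\<exists>us. legal_open_nbh_seq G us \<and> length us + card B = card S \<and>
    (\<Union>u \<in> set us. nbh G u) \<subseteq> S \<and> S \<subseteq> pverts G"
  using assms(3)
proof (induction rule: rtranclp_induct)
  case base
  show ?case by (rule exI[of _ "[]"]) (auto simp: legal_open_nbh_seq_def BV)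
next
  case (step S T)
  then obtain us where us: "legal_open_nbh_seq G us" "length us + card B = card S"
      "(\<Union>u \<in> set us. nbh G u) \<subseteq> S" "S \<subseteq> pverts G" by blast
  obtain u v where uv: "u \<in> pverts G" "v \<in> pverts G" "nbh G u - S = {v}" "T = insert v S"
    using step.hyps(2) by (auto simp: skew_force_def)
  have "u \<notin> set us" using us(3) uv(3) by auto
  have new: "nbh G u - (\<Union>j<length us. nbh G (us ! j)) \<noteq> {}"
  proof -
    have "v \<notin> nbh G (us ! j)" if "j < length us" for j
      using us(3) uv(3) nth_mem[OF that] by blast
    then show ?thesis using uv(3) by auto
  qed
  have "legal_open_nbh_seq G (us @ [u])"
    using us(1) uv(1) \<open>u \<notin> set us\<close> new
    by (auto simp: legal_open_nbh_seq_def nth_append less_Suc_eq)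
  moreover have "length (us @ [u]) + card B = card T"
  proof -
    have "finite S" "v \<notin> S" using us(4) fin finite_subset uv(3) by blast+
    then show ?thesis using us(2) uv(4) by simp
  qed
  moreover have "(\<Union>w \<in> set (us @ [u]). nbh G w) \<subseteq> T" "T \<subseteq> pverts G"
    using us(3,4) uv by auto
  ultimately show ?case by blast
qed

text \<open>
  Conversely, let \<open>w i\<close> be a new neighbour of the \<open>i\<close>-th vertex of a legal sequence and colour exactly
  these witnesses white. A later witness is not adjacent to an earlier vertex, so the sequence
  forces its witnesses one after another.
\<close>
lemma skew_zero_forcing_set_of_legal_seq:
  assumes fin: "finite (pverts G)" and nbhV: "\<And>u. nbh G u \<subseteq> pverts G"
    and legal: "legal_open_nbh_seq G us"
  shows "\<exists>B. skew_zero_forcing_set G B \<and> length us + card B = card (pverts G)"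
proof -
  define k where "k = length us"
  have "\<forall>i. \<exists>w. i < k \<longrightarrow> w \<in> nbh G (us ! i) - (\<Union>j<i. nbh G (us ! j))"
    using legal by (auto simp: legal_open_nbh_seq_def k_def)
  then obtain w where w: "\<And>i. i < k \<Longrightarrow> w i \<in> nbh G (us ! i) - (\<Union>j<i. nbh G (us ! j))"
    by metis
  have inj: "inj_on w {..<k}"
  proof (rule linorder_inj_onI)
    show "w i \<noteq> w j" if "i < j" "i \<in> {..<k}" "j \<in> {..<k}" for i j
      using w[of i] w[of j] that by (metis DiffD1 DiffD2 UN_I lessThan_iff)
  qed auto
  have wV: "w ` {..<k} \<subseteq> pverts G" using w nbhV by blast
  let ?B = "pverts G - w ` {..<k}"
  have "skew_zero_forcing_set G ?B"
  proof (rule skew_zero_forcing_set_if_rank[where rk = "inv_into {..<k} w", OF fin])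
    fix v assume "v \<in> pverts G - ?B"
    then obtain i where i: "i < k" "v = w i" by auto
    have "us ! i \<in> pverts G"
      using legal i by (auto simp: legal_open_nbh_seq_def k_def)
    moreover have "x \<in> ?B \<or> x \<in> pverts G \<and> inv_into {..<k} w x < inv_into {..<k} w v"
      if x: "x \<in> nbh G (us ! i) - {v}" for x
    proof (cases "x \<in> ?B")
      case False
      then obtain j where j: "j < k" "x = w j" using x nbhV by blast
      have "j \<noteq> i" using x i j by auto
      moreover have "\<not> i < j" using w[OF j(1)] x j by auto
      ultimately show ?thesis using i j inj wV by (auto simp: inv_into_f_f)
    qed simp
    ultimately show "\<exists>u \<in> pverts G. v \<in> nbh G u \<and> (\<forall>x \<in> nbh G u - {v}. x \<in> ?B \<or>
        x \<in> pverts G \<and> inv_into {..<k} w x < inv_into {..<k} w v)"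
      using w[OF i(1)] i(2) by blast
  qed auto
  moreover have "k + card ?B = card (pverts G)"
    using card_Diff_subset[of "w ` {..<k}" "pverts G"] wV card_mono[OF fin wV] card_image[OF inj]
    by simp
  ultimately show ?thesis by (auto simp: k_def)
qed

lemma skew_zero_forcing_number_eqI:
  assumes fin: "finite (pverts G)"
    and "skew_zero_forcing_set G B" "card B \<le> r"
    and lower: "\<And>B'. skew_zero_forcing_set G B' \<Longrightarrow> r \<le> card B'"
  shows "skew_zero_forcing_number G = r"
proof -
  have "card B = r" using assms by (intro antisym) auto
  then show ?thesis
    unfolding skew_zero_forcing_number_def
    using assms skew_zero_forcing_sets_wf(1)[OF fin] by (intro Min_eqI) auto
qed

lemma grundy_total_domination_number_eq:
  assumes fin: "finite (pverts G)" and nbhV: "\<And>u. nbh G u \<subseteq> pverts G"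
  shows "grundy_total_domination_number G = card (pverts G) - skew_zero_forcing_number G"
proof -
  let ?Z = "{B. skew_zero_forcing_set G B}"
  have finZ: "finite (card ` ?Z)" and neZ: "card ` ?Z \<noteq> {}"
    using skew_zero_forcing_sets_wf[OF fin] by auto
  from Min_in[OF finZ neZ] obtain B where
    B: "skew_zero_forcing_set G B" "card B = skew_zero_forcing_number G"
    by (auto simp: skew_zero_forcing_number_def)
  then obtain us where us: "legal_open_nbh_seq G us" "length us + card B = card (pverts G)"
    using legal_seq_of_skew_forces[OF fin, of B "pverts G"]
    by (auto simp: skew_zero_forcing_set_def)
  have "length vs \<le> length us" if vs: "legal_open_nbh_seq G vs" for vs
  proof -
    obtain B' where B': "skew_zero_forcing_set G B'" "length vs + card B' = card (pverts G)"
      using skew_zero_forcing_set_of_legal_seq[OF fin nbhV vs] by blast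
    have "skew_zero_forcing_number G \<le> card B'"
      unfolding skew_zero_forcing_number_def using finZ B'(1) by (intro Min_le) auto
    then show ?thesis using B' us B by simp
  qed
  then have "grundy_total_domination_number G = length us"
    unfolding grundy_total_domination_number_def
    using us legal_open_nbh_seqs_wf(1)[OF fin] by (intro Max_eqI) auto
  then show ?thesis using us B by simp
qed

section \<open>An isoperimetric inequality along the forcing process\<close>

text \<open>
  With \<open>S\<close> blue, this is the set of vertices of \<open>Y\<close> that cannot force any more.
\<close>
definition interior_in :: "'a pair_pre_digraph \<Rightarrow> 'a set \<Rightarrow> 'a set \<Rightarrow> 'a set" where
  "interior_in G Y S = {u \<in> Y. nbh G u \<subseteq> S}"

text \<open>
  A forcer enters the interior at the moment when it acts. So each new blue vertex of \<open>X\<close> is paid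
  for by a new interior vertex, and \<open>card (S \<inter> X) - card (interior_in G Y S)\<close>, a measure of the
  boundary of \<open>S\<close>, never exceeds the number of initially blue vertices of \<open>X\<close>. For a bipartite
  graph \<open>X\<close> and \<open>Y\<close> will be the two classes, because the two halves of the forcing process do not interact.
\<close>
lemma skew_force_isoperimetric:
  assumes fin: "finite (pverts G)" and BV: "B \<subseteq> pverts G" and YV: "Y \<subseteq> pverts G"
    and XY: "\<And>u. u \<in> pverts G \<Longrightarrow> nbh G u \<inter> X \<noteq> {} \<Longrightarrow> u \<in> Y"
    and "(skew_force G)\<^sup>*\<^sup>* B S"
  shows "S \<subseteq> pverts G \<and> card (S \<inter> X) \<le> card (B \<inter> X) + card (interior_in G Y S)"
  using assms(5)
proof (induction rule: rtranclp_induct)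
  case base
  then show ?case using BV by simp
next
  case (step S T)
  obtain u v where uv: "u \<in> pverts G" "v \<in> pverts G" "nbh G u - S = {v}" "T = insert v S"
    using step.hyps(2) by (auto simp: skew_force_def)
  have finS: "finite S" using step.IH fin finite_subset by blast
  have finI: "finite (interior_in G Y R)" for R
    using YV fin by (auto simp: interior_in_def intro: finite_subset)
  show ?case
  proof (cases "v \<in> X")
    case True
    then have "u \<in> Y" using XY uv by blast
    then have "insert u (interior_in G Y S) \<subseteq> interior_in G Y T"
      using uv by (auto simp: interior_in_def)
    moreover have "u \<notin> interior_in G Y S" using uv by (auto simp: interior_in_def)
    ultimately have "Suc (card (interior_in G Y S)) \<le> card (interior_in G Y T)"
      using card_mono[OF finI, of "insert u (interior_in G Y S)"] finI by simp
    moreover have "card (T \<inter> X) = Suc (card (S \<inter> X))"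
    proof -
      have "T \<inter> X = insert v (S \<inter> X)" "v \<notin> S" using True uv by auto
      then show ?thesis using finS by simp
    qed
    ultimately show ?thesis using step.IH uv by auto
  next
    case False
    have "card (interior_in G Y S) \<le> card (interior_in G Y T)"
      using uv by (intro card_mono[OF finI]) (auto simp: interior_in_def)
    then show ?thesis using False step.IH uv by auto
  qed
qed

text \<open>
  Blue sets grow by one vertex at a time from \<open>{}\<close> to the full vertex set: first the vertices of
  \<open>B\<close> are inserted one by one, where the bound on the boundary is trivial, and then the forces
  happen. Hence the bound holds on both sides of the step at which a given property first appears.
  Starting from \<open>{}\<close> rather than from \<open>B\<close> makes such a step exist for each \<open>P\<close>.
\<close>
lemma skew_forcing_crossing:
  assumes fin: "finite (pverts G)" and YV: "Y \<subseteq> pverts G"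
    and XY: "\<And>u. u \<in> pverts G \<Longrightarrow> nbh G u \<inter> X \<noteq> {} \<Longrightarrow> u \<in> Y"
    and B: "skew_zero_forcing_set G B"
    and P: "\<not> P {}" "P (pverts G)"
  obtains S v where "S \<subseteq> pverts G" "v \<in> pverts G" "\<not> P S" "P (insert v S)"
    "card (S \<inter> X) \<le> card (B \<inter> X) + card (interior_in G Y S)"
    "card (insert v S \<inter> X) \<le> card (B \<inter> X) + card (interior_in G Y (insert v S))"
proof -
  have BV: "B \<subseteq> pverts G" and reach: "(skew_force G)\<^sup>*\<^sup>* B (pverts G)"
    using B by (auto simp: skew_zero_forcing_set_def)
  have finB: "finite B" using BV fin finite_subset by blast
  let ?ok = "\<lambda>S. card (S \<inter> X) \<le> card (B \<inter> X) + card (interior_in G Y S)"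
  let ?goal = "\<exists>S v. S \<subseteq> pverts G \<and> v \<in> pverts G \<and> \<not> P S \<and> P (insert v S) \<and>
    ?ok S \<and> ?ok (insert v S)"
  have sub: "?ok S" if "S \<subseteq> B" for S
    using that finB by (intro trans_le_add1 card_mono) auto
  have "?goal"
  proof (cases "P B")
    case True
    have "P S \<longrightarrow> ?goal" if "finite S" "S \<subseteq> B" for S
      using that
    proof (induction rule: finite_induct)
      case empty
      then show ?case using P by simp
    next
      case (insert v S)
      then show ?case using sub[of S] sub[of "insert v S"] BV by blast
    qed
    then show ?thesis using True finB by blast
  next
    case False
    have "P S \<longrightarrow> ?goal" if "(skew_force G)\<^sup>*\<^sup>* B S" for S
      using that
    proof (induction rule: rtranclp_induct)
      case base
      then show ?case using False by simp
    next
      case (step S T)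
      obtain v where v: "v \<in> pverts G" "T = insert v S"
        using step.hyps(2) by (auto simp: skew_force_def)
      have "(skew_force G)\<^sup>*\<^sup>* B T" using step.hyps by auto
      then show ?case
        using step v skew_force_isoperimetric[OF fin BV YV XY, where S = S]
          skew_force_isoperimetric[OF fin BV YV XY, where S = T] by blast
    qed
    then show ?thesis using reach P by blast
  qed
  then show thesis using that by blast
qed

section \<open>The torus in periodic coordinates\<close>

abbreviation torus :: "nat \<Rightarrow> nat \<Rightarrow> (nat \<times> nat) pair_pre_digraph" where
  "torus m n \<equiv> cycle_graph m \<box> cycle_graph n"

lemma pverts_cycle_graph: "pverts (cycle_graph m) = {0..<m}"
  by (simp add: cycle_graph_def)

lemma pverts_torus: "pverts (torus m n) = {0..<m} \<times> {0..<n}"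
  by (simp add: cart_prod_def cycle_graph_def)

lemma nbh_torus_subset: "nbh (torus m n) u \<subseteq> pverts (torus m n)"
  by (auto simp: nbh_def cart_prod_def)

lemma cycle_graph_arc_iff:
  assumes "3 \<le> m"
  shows "(nat (x mod int m), j) \<in> parcs (cycle_graph m) \<longleftrightarrow>
    j = nat ((x + 1) mod int m) \<or> j = nat ((x - 1) mod int m)"
proof -
  define i where "i = nat (x mod int m)"
  have i: "int i = x mod int m" "i < m" using assms by (auto simp: i_def nat_less_iff)
  have succ: "j = (i + 1) mod m \<longleftrightarrow> j = nat ((x + 1) mod int m)"
  proof -
    have "int ((i + 1) mod m) = (x + 1) mod int m"
      using i(1) by (simp add: of_nat_mod mod_simps add.commute)
    then show ?thesis by (metis nat_int)
  qed
  have pred: "j < m \<and> i = (j + 1) mod m \<longleftrightarrow> j = nat ((x - 1) mod int m)"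
  proof
    assume j: "j < m \<and> i = (j + 1) mod m"
    then have "(int j + 1) mod int m = x mod int m"
      using i(1) by (simp add: of_nat_mod add.commute)
    then have "(int j + 1 - 1) mod int m = (x - 1) mod int m"
      by (metis mod_diff_left_eq)
    then show "j = nat ((x - 1) mod int m)" using j by simp
  next
    assume j: "j = nat ((x - 1) mod int m)"
    then have "int j = (x - 1) mod int m" using assms by simp
    then have "int ((j + 1) mod m) = (x - 1 + 1) mod int m"
      by (simp only: of_nat_mod of_nat_add of_nat_1 mod_add_left_eq)
    then show "j < m \<and> i = (j + 1) mod m"
      using j assms by (simp add: i_def nat_less_iff)
  qed
  have "nat ((x + 1) mod int m) < m" "nat ((x - 1) mod int m) < m"
    using assms by (auto simp: nat_less_iff)
  then show ?thesis
    using succ pred i(2) by (auto simp: cycle_graph_def i_def[symmetric])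
qed

lemma int_mod_add_neq:
  assumes "d mod int k \<noteq> 0"
  shows "(x + d) mod int k \<noteq> x mod int k"
  using assms by (metis add_diff_cancel_left' mod_0_imp_dvd mod_eq_0_iff_dvd mod_eq_dvd_iff)

locale torus_coords =
  fixes m n :: nat
  assumes m3: "3 \<le> m" and n3: "3 \<le> n"
begin

text \<open>
  Integer coordinates, periodic with periods \<open>m\<close> and \<open>n\<close>; walks around the torus then need no case
  distinction at the seam. The points with the same second coordinate are called a column, those
  with the same first coordinate a row.
\<close>
definition pt :: "int \<Rightarrow> int \<Rightarrow> nat \<times> nat" where
  "pt x y = (nat (x mod int m), nat (y mod int n))"

lemma pt_in_verts [simp]: "pt x y \<in> pverts (torus m n)"
  using m3 n3 by (auto simp: pt_def pverts_torus nat_less_iff)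

lemma pt_eq_iff: "pt x y = pt x' y' \<longleftrightarrow> x mod int m = x' mod int m \<and> y mod int n = y' mod int n"
  using m3 n3 by (auto simp: pt_def nat_eq_iff2)

lemma pt_shift_eq: "pt x y = pt x' y' \<Longrightarrow> pt (x + d) (y + e) = pt (x' + d) (y' + e)"
  by (metis pt_eq_iff mod_add_left_eq)

lemma vertE:
  assumes "v \<in> pverts (torus m n)"
  obtains x y where "v = pt x y" "0 \<le> x" "x < int m" "0 \<le> y" "y < int n"
proof
  show "v = pt (int (fst v)) (int (snd v))"
    using assms by (auto simp: pt_def pverts_torus)
qed (use assms in \<open>auto simp: pverts_torus\<close>)

lemma nbh_pt: "nbh (torus m n) (pt x y) = {pt (x + 1) y, pt (x - 1) y, pt x (y + 1), pt x (y - 1)}"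
proof -
  have "v \<in> nbh (torus m n) (pt x y) \<longleftrightarrow>
      v \<in> {pt (x + 1) y, pt (x - 1) y, pt x (y + 1), pt x (y - 1)}" for v
  proof -
    obtain i j where v: "v = (i, j)" by force
    have "nat (x mod int m) < m" "nat (y mod int n) < n"
      "nat ((x + 1) mod int m) < m" "nat ((x - 1) mod int m) < m"
      "nat ((y + 1) mod int n) < n" "nat ((y - 1) mod int n) < n"
      using m3 n3 by (auto simp: nat_less_iff)
    then show ?thesis
      using cycle_graph_arc_iff[OF m3, of x i] cycle_graph_arc_iff[OF n3, of y j]
      by (simp add: v nbh_def cart_prod_def pt_def pverts_cycle_graph) blast
  qed
  then show ?thesis by blast
qed

lemma finite_verts: "finite (pverts (torus m n))"
  by (simp add: pverts_torus)

section \<open>Counting along lines\<close>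

text \<open>
  Translation by \<open>(- d, - e)\<close> moves an interior point to one of its neighbours. It thus embeds the
  interior into \<open>S \<inter> X\<close>, and the counted points are those outside the image. So each choice of
  one of the four directions bounds the boundary of \<open>S\<close> from below.
\<close>
lemma card_interior_add_card_boundary_le:
  assumes YV: "Y \<subseteq> pverts (torus m n)" and SX: "finite (S \<inter> X)"
    and unit: "\<bar>d\<bar> + \<bar>e\<bar> = 1"
    and YX: "\<And>u. u \<in> Y \<Longrightarrow> nbh (torus m n) u \<subseteq> X"
  shows "card (interior_in (torus m n) Y S) +
    card {pt x y | x y. pt x y \<in> S \<inter> X \<and> pt (x + d) (y + e) \<notin> interior_in (torus m n) Y S}
    \<le> card (S \<inter> X)"
proof -
  let ?I = "interior_in (torus m n) Y S"
  let ?D = "{pt x y | x y. pt x y \<in> S \<inter> X \<and> pt (x + d) (y + e) \<notin> ?I}"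
  define sh where "sh v = pt (int (fst v) - d) (int (snd v) - e)" for v
  have sh_pt: "sh (pt x y) = pt (x - d) (y - e)" for x y
    using m3 n3 by (auto simp: sh_def pt_eq_iff) (auto simp: pt_def mod_diff_left_eq)
  have IV: "?I \<subseteq> pverts (torus m n)" using YV by (auto simp: interior_in_def)
  have inj: "inj_on sh ?I"
  proof (rule inj_onI)
    fix u v assume u: "u \<in> ?I" and v: "v \<in> ?I" and eq: "sh u = sh v"
    obtain x y where xy: "u = pt x y" using u IV vertE by blast
    obtain x' y' where xy': "v = pt x' y'" using v IV vertE by blast
    have "pt (x - d) (y - e) = pt (x' - d) (y' - e)" using eq xy xy' sh_pt by simp
    from pt_shift_eq[OF this, of d e] show "u = v" using xy xy' by simp
  qed
  have img: "sh ` ?I \<subseteq> S \<inter> X"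
  proof
    fix w assume "w \<in> sh ` ?I"
    then obtain u where u: "u \<in> ?I" "w = sh u" by blast
    then obtain x y where xy: "u = pt x y" using IV vertE by blast
    have "(d, e) \<in> {(1, 0), (-1, 0), (0, 1), (0, -1)}" using unit by auto
    then have "w \<in> nbh (torus m n) u" using u xy sh_pt nbh_pt by auto
    then show "w \<in> S \<inter> X" using u YX[of u] unfolding interior_in_def by blast
  qed
  have disj: "sh ` ?I \<inter> ?D = {}"
  proof (rule ccontr)
    assume "sh ` ?I \<inter> ?D \<noteq> {}"
    then obtain u where uI: "u \<in> ?I" "sh u \<in> ?D" by blast
    then obtain x y where u: "u \<in> ?I" "sh u = pt x y" "pt (x + d) (y + e) \<notin> ?I" by blast
    then obtain x' y' where xy: "u = pt x' y'" using IV vertE by blast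
    have "pt (x' - d) (y' - e) = pt x y" using u xy sh_pt by simp
    from pt_shift_eq[OF this, of d e] show False using u xy by simp
  qed
  have DS: "?D \<subseteq> S \<inter> X" by auto
  have "card ?I + card ?D = card (sh ` ?I \<union> ?D)"
    using disj finite_subset[OF img SX] finite_subset[OF DS SX] card_image[OF inj]
    by (simp add: card_Un_disjoint)
  also have "\<dots> \<le> card (S \<inter> X)" using img DS by (intro card_mono[OF SX]) auto
  finally show ?thesis .
qed

end

text \<open>
  The vertices to be forced are in \<open>X\<close>, their forcers in \<open>Y\<close>. On a bipartite torus these are the two
  colour classes; if \<open>m\<close> is odd, both are the full vertex set. The condition \<open>line\<close> says that
  the relevant points of a column form a single cycle under steps of length two. This holds for
  columns of odd length \<open>m\<close>, and it holds for even \<open>m\<close> after restriction to the classes.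
\<close>
locale torus_class = torus_coords +
  fixes X Y :: "(nat \<times> nat) set"
  assumes X_verts: "X \<subseteq> pverts (torus m n)" and Y_verts: "Y \<subseteq> pverts (torus m n)"
    and X_iff_x: "\<And>x y. pt x y \<in> X \<longleftrightarrow> pt (x + 1) y \<in> Y"
    and X_iff_y: "\<And>x y. pt x y \<in> X \<longleftrightarrow> pt x (y + 1) \<in> Y"
    and Y_iff_x: "\<And>x y. pt x y \<in> Y \<longleftrightarrow> pt (x + 1) y \<in> X"
    and Y_iff_y: "\<And>x y. pt x y \<in> Y \<longleftrightarrow> pt x (y + 1) \<in> X"
    and line: "\<And>x x' y. pt x y \<in> Y \<Longrightarrow> pt x' y \<in> X \<Longrightarrow> \<exists>k::nat. pt x y = pt (x' - 1 - 2 * int k) y"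
begin

abbreviation "I \<equiv> interior_in (torus m n) Y"

lemma nbh_Y: "nbh (torus m n) u \<subseteq> X" if u: "u \<in> Y"
proof -
  obtain x y where xy: "u = pt x y" using u Y_verts vertE by blast
  show ?thesis
    using u Y_iff_x[of x y] Y_iff_y[of x y] X_iff_x[of "x - 1" y] X_iff_y[of x "y - 1"]
    by (simp add: xy nbh_pt)
qed

lemma nbh_X: "u \<in> pverts (torus m n) \<Longrightarrow> nbh (torus m n) u \<inter> X \<noteq> {} \<Longrightarrow> u \<in> Y"
proof -
  assume "u \<in> pverts (torus m n)" and ne: "nbh (torus m n) u \<inter> X \<noteq> {}"
  then obtain x y where xy: "u = pt x y" using vertE by blast
  show "u \<in> Y"
    using ne Y_iff_x[of x y] Y_iff_y[of x y] X_iff_x[of "x - 1" y] X_iff_y[of x "y - 1"]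
    by (auto simp: xy nbh_pt)
qed

lemma pt_interior_iff: "pt x y \<in> I S \<longleftrightarrow> pt x y \<in> Y \<and>
    pt (x + 1) y \<in> S \<and> pt (x - 1) y \<in> S \<and> pt x (y + 1) \<in> S \<and> pt x (y - 1) \<in> S"
  by (auto simp: interior_in_def nbh_pt)

text \<open>
  If every point of \<open>S \<inter> X\<close> in the column had an interior predecessor, then \<open>S\<close> would be closed
  under steps of length two down the column. As these steps visit the whole column, every point
  of \<open>Y\<close> on it would be interior.
\<close>
lemma column_boundary:
  assumes meets: "pt x0 y \<in> S \<inter> X" and notfull: "pt x1 y \<in> Y" "pt x1 y \<notin> I S"
  shows "\<exists>x. pt x y \<in> S \<inter> X \<and> pt (x - 1) y \<notin> I S"
proof (rule ccontr)
  assume neg: "\<nexists>x. pt x y \<in> S \<inter> X \<and> pt (x - 1) y \<notin> I S"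
  have all: "pt (x0 - 2 * int k) y \<in> S \<inter> X" for k
  proof (induction k)
    case (Suc k)
    then have "pt (x0 - 2 * int k - 1) y \<in> I S" using neg by blast
    then have "pt (x0 - 2 * int k - 1 - 1) y \<in> S" "pt (x0 - 2 * int k - 1 - 1) y \<in> X"
      using X_iff_x[of "x0 - 2 * int k - 1 - 1" y] by (auto simp: pt_interior_iff)
    then show ?case by (simp add: algebra_simps)
  qed (use meets in simp)
  obtain k where k: "pt x1 y = pt (x0 - 1 - 2 * int k) y"
    using line notfull(1) meets by blast
  have "pt (x0 - 2 * int k - 1) y \<in> I S" using neg all[of k] by blast
  then show False using k notfull(2) by (simp add: algebra_simps)
qed

lemma card_le_if_columns_meet:
  assumes S: "S \<subseteq> pverts (torus m n)"
    and meets: "\<And>y. \<exists>x. pt x y \<in> S \<inter> X"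
    and notfull: "\<And>y. \<exists>x. pt x y \<in> Y \<and> pt x y \<notin> I S"
  shows "card (I S) + n \<le> card (S \<inter> X)"
proof -
  let ?D = "{pt x y | x y. pt x y \<in> S \<inter> X \<and> pt (x + (-1)) (y + 0) \<notin> I S}"
  have fin: "finite (S \<inter> X)" using S finite_verts finite_subset by blast
  have "{0..<n} \<subseteq> snd ` ?D"
  proof
    fix j assume j: "j \<in> {0..<n}"
    obtain x where "pt x (int j) \<in> S \<inter> X" "pt (x - 1) (int j) \<notin> I S"
      using column_boundary meets[of "int j"] notfull[of "int j"] by metis
    then have "pt x (int j) \<in> ?D" by auto
    moreover have "j = snd (pt x (int j))" using j by (simp add: pt_def)
    ultimately show "j \<in> snd ` ?D" by (rule rev_image_eqI)
  qed
  moreover have finD: "finite ?D" by (rule finite_subset[OF _ fin]) auto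
  ultimately have "card {0..<n} \<le> card (snd ` ?D)" by (intro card_mono) auto
  also have "\<dots> \<le> card ?D" using finD by (rule card_image_le)
  finally show ?thesis
    using card_interior_add_card_boundary_le[OF Y_verts fin _ nbh_Y, of "-1" 0] by simp
qed

text \<open>
  The set whose complete coverage is the event at which the forcing process is stopped.
\<close>
definition two_columns :: "int \<Rightarrow> (nat \<times> nat) set" where
  "two_columns y = {pt x y' | x y'. y' \<in> {y, y + 1} \<and> pt x y' \<in> X}"

text \<open>
  Walk along the row from a blue point in steps of length two, as long as the point stepped over is
  interior. Points in column \<open>c\<close> and its neighbours see the empty column \<open>c\<close> and are not interior,
  so the walk stops before \<open>c\<close>. The parity of the place where it stops records the parity of the
  place where it started.
\<close>
lemma row_boundary:
  assumes start: "pt x y \<in> S \<inter> X" and empty: "\<And>x. pt x c \<notin> S \<inter> X" and "y < c"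
  shows "\<exists>e. y \<le> e \<and> e < c \<and> even (e - y) \<and> pt x e \<in> S \<inter> X \<and> pt x (e + 1) \<notin> I S"
proof (rule ccontr)
  assume neg: "\<not> ?thesis"
  have all: "y + 2 * int k < c \<longrightarrow> pt x (y + 2 * int k) \<in> S \<inter> X" for k
  proof (induction k)
    case (Suc k)
    show ?case
    proof
      assume lt: "y + 2 * int (Suc k) < c"
      then have "pt x (y + 2 * int k) \<in> S \<inter> X" using Suc by simp
      then have "pt x (y + 2 * int k + 1) \<in> I S" using neg lt by force
      then have "pt x (y + 2 * int k + 1 + 1) \<in> S" "pt x (y + 2 * int k + 1 + 1) \<in> X"
        using Y_iff_y[of x "y + 2 * int k + 1"] by (auto simp: pt_interior_iff)
      then show "pt x (y + 2 * int (Suc k)) \<in> S \<inter> X" by (simp add: algebra_simps)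
    qed
  qed (use start in simp)
  define k where "k = nat ((c - 1 - y) div 2)"
  have k: "2 * int k = 2 * ((c - 1 - y) div 2)" using \<open>y < c\<close> by (simp add: k_def)
  define e where "e = y + 2 * int k"
  have e: "e = c - 1 \<or> e = c - 2" "e < c" using k unfolding e_def by presburger+
  have int: "pt x (e + 1) \<in> I S" using all[of k] neg e(2) unfolding e_def by force
  then have "nbh (torus m n) (pt x (e + 1)) \<subseteq> S \<inter> X"
    using nbh_Y by (auto simp: interior_in_def)
  then have "pt (x + 1) (e + 1) \<in> S \<inter> X" "pt x (e + 1 + 1) \<in> S \<inter> X" by (auto simp: nbh_pt)
  then show False using e(1) empty[of "x + 1"] empty[of x] by auto
qed

text \<open>
  From each point of the two full columns start the walk of the preceding lemma towards the empty
  column. The walks of the two points in one row have different parity and stop before they have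
  gone around, so they stop at different places.
\<close>
lemma card_le_if_column_empty:
  assumes S: "S \<subseteq> pverts (torus m n)" and full: "two_columns y \<subseteq> S"
    and empty: "\<And>x. pt x c \<notin> S \<inter> X"
  shows "card (I S) + card (two_columns y) \<le> card (S \<inter> X)"
proof -
  let ?D = "{pt x y | x y. pt x y \<in> S \<inter> X \<and> pt (x + 0) (y + 1) \<notin> I S}"
  have fin: "finite (S \<inter> X)" using S finite_verts finite_subset by blast
  \<comment> \<open>the representative of \<open>c\<close> in the period that starts at \<open>y\<close>\<close>
  define c' where "c' = y + (c - y) mod int n"
  have c'c: "pt x c' = pt x c" for x by (simp add: c'_def pt_eq_iff mod_add_right_eq)
  have c'_le: "y \<le> c'" "c' < y + int n" using n3 by (auto simp: c'_def)
  have c': "y' < c'" if v: "pt x y' \<in> two_columns y" "y' \<in> {y, y + 1}" for x y'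
  proof -
    have "pt x y' \<in> X" using v by (auto simp: two_columns_def)
    then have "pt (x + 1) (y' + 1) \<in> X" "pt (x + 1) (y' - 1) \<in> X" "pt x y' \<in> X"
      using X_iff_x Y_iff_y[of "x + 1" y'] X_iff_y[of "x + 1" "y' - 1"] by auto
    then have "\<exists>x. pt x y \<in> X" "\<exists>x. pt x (y + 1) \<in> X" using v(2) by auto
    then have "\<exists>x. pt x y \<in> S \<inter> X" "\<exists>x. pt x (y + 1) \<in> S \<inter> X"
      using full unfolding two_columns_def by blast+
    then have "c' \<noteq> y" "c' \<noteq> y + 1" using empty c'c by metis+
    then show ?thesis using c'_le(1) v(2) by auto
  qed
  define R where "R v w \<longleftrightarrow> (\<exists>x y' e. v = pt x y' \<and> w = pt x e \<and> y' \<in> {y, y + 1} \<and>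
    y \<le> e \<and> e < y + int n \<and> even (e - y'))" for v w
  have "\<forall>v \<in> two_columns y. \<exists>w. w \<in> ?D \<and> R v w"
  proof
    fix v assume True: "v \<in> two_columns y"
    then obtain x y' where v: "v = pt x y'" "y' \<in> {y, y + 1}" "pt x y' \<in> X"
      by (auto simp: two_columns_def)
    have "pt x y' \<in> S \<inter> X" using True v full by auto
    then obtain e where "y' \<le> e" "e < c'" "even (e - y')" "pt x e \<in> S \<inter> X"
        "pt x (e + 1) \<notin> I S"
      using row_boundary[of x y' S c'] c' True v empty c'c by auto
    note e = this
    then have "pt x (e + 1) \<notin> I S" "pt x e \<in> S \<inter> X" by auto
    then have "pt x e \<in> ?D" unfolding add_0_right by blast
    moreover have "R v (pt x e)"
      unfolding R_def using v(1,2) e(1-3) c'_le(2)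
      by (intro exI[of _ x] exI[of _ y'] exI[of _ e] conjI) auto
    ultimately show "\<exists>w. w \<in> ?D \<and> R v w" by blast
  qed
  from bchoice[OF this] obtain h
    where h: "\<forall>v \<in> two_columns y. h v \<in> ?D \<and> R v (h v)" ..
  have R_inj: "v = v'" if vw: "R v w" "R v' w" for v v' w
  proof -
    obtain x y1 e where 1: "v = pt x y1" "w = pt x e" "y1 \<in> {y, y + 1}"
        "y \<le> e" "e < y + int n" "even (e - y1)" using vw(1) by (auto simp: R_def)
    obtain x' y1' e' where 2: "v' = pt x' y1'" "w = pt x' e'" "y1' \<in> {y, y + 1}"
        "y \<le> e'" "e' < y + int n" "even (e' - y1')" using vw(2) by (auto simp: R_def)
    have eq: "x mod int m = x' mod int m" "e mod int n = e' mod int n"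
      using 1(2) 2(2) by (auto simp: pt_eq_iff)
    have "int n dvd e - e'" using eq(2) by (simp add: mod_eq_dvd_iff)
    then have "e = e'" using 1 2 zdvd_imp_le[of "int n" "e - e'"] zdvd_imp_le[of "int n" "e' - e"]
      by (smt (verit) dvd_minus_iff minus_diff_eq)
    then have "y1 = y1'" using 1 2 by auto
    then show ?thesis using 1 2 eq by (simp add: pt_eq_iff)
  qed
  have "inj_on h (two_columns y)"
  proof (rule inj_onI)
    fix u v assume "u \<in> two_columns y" "v \<in> two_columns y" "h u = h v"
    then have "R u (h u)" "R v (h u)" using bspec[OF h] by metis+
    then show "u = v" by (rule R_inj)
  qed
  moreover have "h ` two_columns y \<subseteq> ?D" using h by blast
  moreover have "finite ?D" by (rule finite_subset[OF _ fin]) auto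
  ultimately have "card (two_columns y) \<le> card ?D" by (rule card_inj_on_le)
  then show ?thesis
    using card_interior_add_card_boundary_le[OF Y_verts fin _ nbh_Y, of 0 1] by simp
qed

end

context torus_class
begin

lemma two_columnsI: "y' = y \<or> y' = y + 1 \<Longrightarrow> pt x y' \<in> X \<Longrightarrow> pt x y' \<in> two_columns y"
  unfolding two_columns_def by blast

text \<open>
  Stop the process when, for the first time, two adjacent columns are full. Before that step no
  column is in the interior, as the points of \<open>X\<close> in a column and in the next one are neighbours of
  points of \<open>Y\<close> in that column. If at this time each column meets \<open>S\<close>, then each of the \<open>n\<close>
  columns contributes to the boundary. If some column is empty, it is still empty after the step,
  and then the rows through the two full columns contribute \<open>w\<close> together.
\<close>
lemma min_le_card_forcing_inter:
  assumes w: "\<And>y. card (two_columns y) = w" "0 < w"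
    and B: "skew_zero_forcing_set (torus m n) B"
  shows "min n w \<le> card (B \<inter> X)"
proof -
  define P where "P S \<longleftrightarrow> (\<exists>y. two_columns y \<subseteq> S)" for S
  have P0: "\<not> P {}"
    unfolding P_def using w by (metis card.empty less_irrefl subset_empty)
  have P1: "P (pverts (torus m n))"
    unfolding P_def two_columns_def using X_verts by blast
  obtain S v where Sv: "S \<subseteq> pverts (torus m n)" "v \<in> pverts (torus m n)"
      "\<not> P S" "P (insert v S)" "card (S \<inter> X) \<le> card (B \<inter> X) + card (I S)"
      "card (insert v S \<inter> X) \<le> card (B \<inter> X) + card (I (insert v S))"
  proof (rule skew_forcing_crossing[where P = P and X = X, OF finite_verts Y_verts _ B P0 P1])
    show "u \<in> Y" if "u \<in> pverts (torus m n)" "nbh (torus m n) u \<inter> X \<noteq> {}" for u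
      using nbh_X that .
  qed
  show ?thesis
  proof (cases "\<forall>y. \<exists>x. pt x y \<in> S \<inter> X")
    case True
    have "\<exists>x. pt x y \<in> Y \<and> pt x y \<notin> I S" for y
    proof (rule ccontr)
      assume neg: "\<nexists>x. pt x y \<in> Y \<and> pt x y \<notin> I S"
      have "pt x y' \<in> S" if "pt x y' \<in> X" "y' = y \<or> y' = y + 1" for x y'
        using that(2)
      proof
        assume "y' = y"
        then have "pt (x + 1) y \<in> Y" using that(1) X_iff_x[of x y] by blast
        then have "pt (x + 1) y \<in> I S" using neg by blast
        then show ?thesis using \<open>y' = y\<close> by (simp add: pt_interior_iff)
      next
        assume "y' = y + 1"
        then have "pt x y \<in> Y" using that(1) Y_iff_y[of x y] by blast
        then have "pt x y \<in> I S" using neg by blast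
        then show ?thesis using \<open>y' = y + 1\<close> by (simp add: pt_interior_iff)
      qed
      then have "two_columns y \<subseteq> S" by (auto simp: two_columns_def)
      then show False using Sv(3) by (auto simp: P_def)
    qed
    then have "card (I S) + n \<le> card (S \<inter> X)"
      using card_le_if_columns_meet[OF Sv(1)] True by blast
    then show ?thesis using Sv(5) by simp
  next
    case False
    then obtain c where c: "\<And>x. pt x c \<notin> S \<inter> X" by blast
    obtain y where y: "two_columns y \<subseteq> insert v S" using Sv(4) by (auto simp: P_def)
    have empty: "pt x c \<notin> insert v S \<inter> X" for x
    proof
      assume "pt x c \<in> insert v S \<inter> X"
      then have v: "v = pt x c" using c by blast
      have "two_columns y \<subseteq> S"
      proof (rule ccontr)
        assume "\<not> two_columns y \<subseteq> S"
        then have "v \<in> two_columns y" using y by blast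
        then obtain x1 y1 where 1: "v = pt x1 y1" "y1 = y \<or> y1 = y + 1" "pt x1 y1 \<in> X"
          by (auto simp: two_columns_def)
        have "pt (x1 + 1 + 1) y1 \<in> X" using 1(3) X_iff_x[of x1 y1] Y_iff_x[of "x1 + 1" y1] by blast
        then have X2: "pt (x1 + 2) y1 \<in> X" by (simp add: add.assoc)
        then have "pt (x1 + 2) y1 \<in> two_columns y" using 1(2) by (auto simp: two_columns_def)
        moreover have "pt (x1 + 2) y1 \<noteq> v"
        proof -
          have "2 mod int m \<noteq> 0" using m3 by (simp add: mod_pos_pos_trivial)
          from int_mod_add_neq[OF this] show ?thesis unfolding 1(1) pt_eq_iff by blast
        qed
        ultimately have "pt (x1 + 2) y1 \<in> S \<inter> X" using y X2 by blast
        moreover have "pt (x1 + 2) y1 = pt (x1 + 2) c"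
          using v unfolding 1(1) pt_eq_iff by blast
        ultimately show False using c by metis
      qed
      then show False using Sv(3) by (auto simp: P_def)
    qed
    have "insert v S \<subseteq> pverts (torus m n)" using Sv by blast
    from card_le_if_column_empty[OF this y empty] show ?thesis
      using Sv(6) w(1)[of y] by simp
  qed
qed

end

section \<open>Lower bounds for the two parities\<close>

text \<open>The number \<open>h\<close> is an inverse of 2 modulo \<open>m\<close>.\<close>
lemma odd_int_halfE:
  assumes "odd m"
  obtains h where "2 * h = int m + 1"
  using assms by (metis evenE even_of_nat_iff even_plus_one_iff)

lemma min_le_card_forcing_odd:
  assumes "3 \<le> m" "3 \<le> n" "odd m" and B: "skew_zero_forcing_set (torus m n) B"
  shows "min n (2 * m) \<le> card B"
proof -
  interpret torus_coords m n by unfold_locales (fact assms)+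
  interpret torus_class m n "pverts (torus m n)" "pverts (torus m n)"
  proof unfold_locales
    fix x x' y :: int
    obtain h where h: "2 * h = int m + 1" using odd_int_halfE assms(3) .
    define d where "d = x' - 1 - x"
    \<comment> \<open>the number of steps of length two that amount to a displacement by \<open>d\<close> modulo \<open>m\<close>\<close>
    define k where "k = nat ((d * h) mod int m)"
    have k: "int k = d * h - int m * (d * h div int m)"
      using m3 by (simp add: k_def minus_mult_div_eq_mod)
    have "2 * int k = d * (2 * h) - 2 * int m * (d * h div int m)"
      unfolding k by (simp add: algebra_simps)
    also have "\<dots> = d + int m * (d - 2 * (d * h div int m))"
      unfolding h by (simp add: algebra_simps)
    finally have "x - (x' - 1 - 2 * int k) = int m * (d - 2 * (d * h div int m))"
      by (simp add: d_def)
    then show "\<exists>k::nat. pt x y = pt (x' - 1 - 2 * int k) y"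
      by (intro exI[of _ k]) (simp add: pt_eq_iff mod_eq_dvd_iff)
  qed auto
  have "card (two_columns y) = 2 * m" for y
  proof -
    let ?f = "\<lambda>(x, b). pt x (y + b)"
    have "two_columns y = ?f ` ({0..<int m} \<times> {0, 1})"
    proof
      show "two_columns y \<subseteq> ?f ` ({0..<int m} \<times> {0, 1})"
      proof
        fix v assume "v \<in> two_columns y"
        then obtain x b where "v = pt x (y + b)" "b \<in> {0, 1}"
          by (force simp: two_columns_def)
        then have "v = ?f (x mod int m, b)" "(x mod int m, b) \<in> {0..<int m} \<times> {0, 1}"
          using m3 by (auto simp: pt_eq_iff)
        then show "v \<in> ?f ` ({0..<int m} \<times> {0, 1})" by blast
      qed
    qed (auto intro!: two_columnsI)
    moreover have "inj_on ?f ({0..<int m} \<times> {0, 1})"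
      using int_mod_add_neq[of 1 n y] n3 by (auto simp: inj_on_def pt_eq_iff)
    ultimately show ?thesis by (simp add: card_image card_cartesian_product)
  qed
  from min_le_card_forcing_inter[OF this _ B] m3
  have "min n (2 * m) \<le> card (B \<inter> pverts (torus m n))" by simp
  also have "B \<inter> pverts (torus m n) = B" using B by (auto simp: skew_zero_forcing_set_def)
  finally show ?thesis .
qed

text \<open>
  The torus is bipartite, and the two colour classes are forced independently of each other. Each
  of them needs \<open>min n m\<close> blue vertices, since two adjacent columns contain only one point of the
  class per row.
\<close>
lemma min_le_card_forcing_even:
  assumes "3 \<le> m" "3 \<le> n" "even m" "even n" and B: "skew_zero_forcing_set (torus m n) B"
  shows "2 * min n m \<le> card B"
proof -
  interpret torus_coords m n by unfold_locales (fact assms)+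
  define cls where "cls p = {v \<in> pverts (torus m n). even (fst v + snd v) = p}" for p
  have pt_cls: "pt x y \<in> cls p \<longleftrightarrow> even (x + y) = p" for x y p
  proof -
    have "even (fst (pt x y)) \<longleftrightarrow> even x" "even (snd (pt x y)) \<longleftrightarrow> even y"
      using assms by (auto simp: pt_def even_nat_iff dvd_mod_iff)
    then show ?thesis by (simp add: cls_def)
  qed
  have cls_verts: "cls p \<subseteq> pverts (torus m n)" for p by (auto simp: cls_def)
  have half: "min n m \<le> card (B \<inter> cls p)" for p
  proof -
    interpret torus_class m n "cls p" "cls (\<not> p)"
    proof unfold_locales
      fix x x' y assume "pt x y \<in> cls (\<not> p)" "pt x' y \<in> cls p"
      then have "even (x' - 1 - x)" by (auto simp: pt_cls)
      then obtain d where d: "x' - 1 - x = 2 * d" by blast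
      define k where "k = nat (d mod int m)"
      have "int k = d - int m * (d div int m)"
        using m3 by (simp add: k_def minus_mult_div_eq_mod)
      then have "x - (x' - 1 - 2 * int k) = int m * (- 2 * (d div int m))"
        using d by (simp add: algebra_simps)
      then show "\<exists>k::nat. pt x y = pt (x' - 1 - 2 * int k) y"
        by (intro exI[of _ k]) (simp only: pt_eq_iff mod_eq_dvd_iff, simp)
    next
      fix x y
      show "pt x y \<in> cls p \<longleftrightarrow> pt (x + 1) y \<in> cls (\<not> p)"
        "pt x y \<in> cls p \<longleftrightarrow> pt x (y + 1) \<in> cls (\<not> p)"
        "pt x y \<in> cls (\<not> p) \<longleftrightarrow> pt (x + 1) y \<in> cls p"
        "pt x y \<in> cls (\<not> p) \<longleftrightarrow> pt x (y + 1) \<in> cls p"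
        by (cases p; simp add: pt_cls; blast)+
    qed (rule cls_verts)+
    have "card (two_columns y) = m" for y
    proof -
      let ?f = "\<lambda>x. pt x (if even (x + y) = p then y else y + 1)"
      have "two_columns y = ?f ` {0..<int m}"
      proof
        show "two_columns y \<subseteq> ?f ` {0..<int m}"
        proof
          fix v assume "v \<in> two_columns y"
          then obtain x y' where v: "v = pt x y'" "y' = y \<or> y' = y + 1" "even (x + y') = p"
            by (auto simp: two_columns_def pt_cls)
          have "even (x mod int m) = even x" using assms by (simp add: dvd_mod_iff)
          then have "v = ?f (x mod int m)" using v by (auto simp: pt_eq_iff)
          then show "v \<in> ?f ` {0..<int m}" using m3 by auto
        qed
        show "?f ` {0..<int m} \<subseteq> two_columns y"
        proof (rule image_subsetI)
          fix x
          show "?f x \<in> two_columns y"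
            by (rule two_columnsI) (cases p; simp add: pt_cls)+
        qed
      qed
      moreover have "inj_on ?f {0..<int m}"
        by (auto simp: inj_on_def pt_eq_iff)
      ultimately show ?thesis by (simp add: card_image)
    qed
    from min_le_card_forcing_inter[OF this _ B] m3 show ?thesis by simp
  qed
  have "B \<subseteq> pverts (torus m n)" using B by (auto simp: skew_zero_forcing_set_def)
  then have "B = (B \<inter> cls True) \<union> (B \<inter> cls False)" "finite B"
    using finite_verts finite_subset by (auto simp: cls_def)
  moreover have "(B \<inter> cls True) \<inter> (B \<inter> cls False) = {}" by (auto simp: cls_def)
  ultimately have "card B = card (B \<inter> cls True) + card (B \<inter> cls False)"
    by (metis card_Un_disjoint finite_Un)
  then show ?thesis using half[of True] half[of False] by simp
qed

section \<open>The square torus of odd side\<close>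

text \<open>
  The fibres of \<open>f\<close> are unions of connected components of the multigraph on \<open>W\<close> with the edges
  \<open>{p e, q e}\<close>, so this says that a graph has at least as many components as it has vertices in
  excess of its edges.
\<close>
lemma card_le_card_image_plus_card_edges:
  fixes p q :: "'e \<Rightarrow> 'w"
  assumes "finite E" "finite W"
  shows "\<exists>f :: 'w \<Rightarrow> 'w. (\<forall>e \<in> E. f (p e) = f (q e)) \<and> card W \<le> card (f ` W) + card E"
  using assms(1)
proof (induction rule: finite_induct)
  case empty
  show ?case by (rule exI[of _ id]) simp
next
  case (insert e E)
  from insert.IH obtain f :: "'w \<Rightarrow> 'w"
    where f: "\<forall>e \<in> E. f (p e) = f (q e)" "card W \<le> card (f ` W) + card E"
    by blast
  define g where "g z = (if f z = f (q e) then f (p e) else f z)" for z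
  have "f ` W \<subseteq> insert (f (q e)) (g ` W)" by (auto simp: g_def)
  then have "card (f ` W) \<le> card (insert (f (q e)) (g ` W))"
    using assms(2) by (intro card_mono) auto
  also have "\<dots> \<le> Suc (card (g ` W))" by (rule card_insert_le_m1) auto
  finally have "card W \<le> card (g ` W) + card (insert e E)" using f insert by simp
  moreover have "\<forall>e' \<in> insert e E. g (p e') = g (q e')" using f by (auto simp: g_def)
  ultimately show ?case by blast
qed

text \<open>
  For odd \<open>m\<close> a vertex \<open>(x, y)\<close> is determined by \<open>x + y\<close> and \<open>x - y\<close> modulo \<open>m\<close>, hence by the
  diagonal and the antidiagonal on which it lies. Read it as an edge of the complete bipartite
  graph between the diagonals and the antidiagonals. The neighbourhood of a vertex then is a
  4-cycle, and a force adds the last edge of a 4-cycle whose other three edges are there already. So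
  forcing does not change the connected components. At the end the graph is connected on \<open>2 * m\<close>
  vertices, so it was connected at the beginning and had at least \<open>2 * m - 1\<close> edges.
\<close>
lemma le_card_forcing_odd_square:
  assumes "3 \<le> m" "odd m" and B: "skew_zero_forcing_set (torus m m) B"
  shows "2 * m - 1 \<le> card B"
proof -
  interpret torus_coords m m by unfold_locales (fact assms)+
  define p :: "nat \<times> nat \<Rightarrow> int + int"
    where "p v = Inl ((int (fst v) + int (snd v)) mod int m)" for v
  define q :: "nat \<times> nat \<Rightarrow> int + int"
    where "q v = Inr ((int (fst v) - int (snd v)) mod int m)" for v
  have p_pt: "p (pt x y) = Inl ((x + y) mod int m)" for x y
    using m3 by (simp add: p_def pt_def mod_simps)
  have q_pt: "q (pt x y) = Inr ((x - y) mod int m)" for x y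
    using m3 by (simp add: q_def pt_def mod_simps)
  define W :: "(int + int) set" where "W = {0..<int m} <+> {0..<int m}"
  have cardW: "card W = 2 * m" "finite W" by (auto simp: W_def card_Plus)
  have BV: "B \<subseteq> pverts (torus m m)" and reach: "(skew_force (torus m m))\<^sup>*\<^sup>* B (pverts (torus m m))"
    using B by (auto simp: skew_zero_forcing_set_def)
  have "finite B" using BV finite_verts finite_subset by blast
  from card_le_card_image_plus_card_edges[OF this cardW(2), of p q] obtain f :: "int + int \<Rightarrow> int + int"
    where f: "\<forall>v \<in> B. f (p v) = f (q v)" "card W \<le> card (f ` W) + card B"
    by blast
  have "\<forall>v \<in> S. f (p v) = f (q v)" if "(skew_force (torus m m))\<^sup>*\<^sup>* B S" for S
    using that
  proof (induction rule: rtranclp_induct)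
    case base
    show ?case using f by blast
  next
    case (step S T)
    obtain u v where uv: "u \<in> pverts (torus m m)" "nbh (torus m m) u - S = {v}" "T = insert v S"
      using step.hyps(2) by (auto simp: skew_force_def)
    obtain x y where u: "u = pt x y" using uv(1) vertE by blast
    \<comment> \<open>the neighbours of \<open>u\<close> lie on two diagonals and two antidiagonals, in all four combinations\<close>
    define g where "g s = f (Inl (s mod int m))" for s
    define h where "h s = f (Inr (s mod int m))" for s
    have fp: "f (p (pt x y)) = g (x + y)" and fq: "f (q (pt x y)) = h (x - y)" for x y
      by (simp_all add: p_pt q_pt g_def h_def)
    define N where "N = {pt (x + 1) y, pt (x - 1) y, pt x (y + 1), pt x (y - 1)}"
    have v: "v \<in> N" using uv(2) by (auto simp: u nbh_pt N_def)
    have others: "f (p w) = f (q w)" if "w \<in> N" "w \<noteq> v" for w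
      using that uv(2) step.IH by (auto simp: u nbh_pt N_def)
    have ne: "(s + 1) mod int m \<noteq> s mod int m" "(s - 1) mod int m \<noteq> s mod int m"
      "(s + 1) mod int m \<noteq> (s - 1) mod int m" for s
      using int_mod_add_neq[of 1 m s] int_mod_add_neq[of 1 m "s - 1"]
        int_mod_add_neq[of 2 m "s - 1"] m3 by (auto simp: add.commute)
    have dist: "pt (x + 1) y \<noteq> pt (x - 1) y" "pt (x + 1) y \<noteq> pt x (y + 1)"
      "pt (x + 1) y \<noteq> pt x (y - 1)" "pt (x - 1) y \<noteq> pt x (y + 1)"
      "pt (x - 1) y \<noteq> pt x (y - 1)" "pt x (y + 1) \<noteq> pt x (y - 1)"
      using ne[of x] ne[of y] by (simp_all add: pt_eq_iff)
    have idx: "x + 1 + y = x + y + 1" "x - 1 + y = x + y - 1" "x + (y + 1) = x + y + 1"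
      "x + (y - 1) = x + y - 1" "x + 1 - y = x - y + 1" "x - 1 - y = x - y - 1"
      "x - (y + 1) = x - y - 1" "x - (y - 1) = x - y + 1" by simp_all
    have e1: "g (x + y + 1) = h (x - y + 1)" if "pt (x + 1) y \<noteq> v"
      using others[of "pt (x + 1) y"] that unfolding N_def fp fq idx by blast
    have e2: "g (x + y - 1) = h (x - y - 1)" if "pt (x - 1) y \<noteq> v"
      using others[of "pt (x - 1) y"] that unfolding N_def fp fq idx by blast
    have e3: "g (x + y + 1) = h (x - y - 1)" if "pt x (y + 1) \<noteq> v"
      using others[of "pt x (y + 1)"] that unfolding N_def fp fq idx by blast
    have e4: "g (x + y - 1) = h (x - y + 1)" if "pt x (y - 1) \<noteq> v"
      using others[of "pt x (y - 1)"] that unfolding N_def fp fq idx by blast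
    consider "v = pt (x + 1) y" | "v = pt (x - 1) y" | "v = pt x (y + 1)" | "v = pt x (y - 1)"
      using v unfolding N_def by blast
    then have "f (p v) = f (q v)"
    proof cases
      case 1
      then have "g (x + y + 1) = h (x - y + 1)" using e2 e3 e4 dist 1 by metis
      then show ?thesis unfolding 1 fp fq idx .
    next
      case 2
      then have "g (x + y - 1) = h (x - y - 1)" using e1 e3 e4 dist 2 by metis
      then show ?thesis unfolding 2 fp fq idx .
    next
      case 3
      then have "g (x + y + 1) = h (x - y - 1)" using e1 e2 e4 dist 3 by metis
      then show ?thesis unfolding 3 fp fq idx .
    next
      case 4
      then have "g (x + y - 1) = h (x - y + 1)" using e1 e2 e3 dist 4 by metis
      then show ?thesis unfolding 4 fp fq idx .
    qed
    then show ?case using step.IH uv(3) by blast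
  qed
  from this[OF reach] have all: "f (p v) = f (q v)" if "v \<in> pverts (torus m m)" for v
    using that by blast
  obtain h where h: "2 * h = int m + 1" using odd_int_halfE assms(2) .
  \<comment> \<open>each diagonal meets each antidiagonal, because 2 is invertible modulo \<open>m\<close>\<close>
  have gh: "f (Inl (r mod int m)) = f (Inr (c mod int m))" for r c
  proof -
    have "(r + c) * h + (r - c) * h = r * (2 * h)" "(r + c) * h - (r - c) * h = c * (2 * h)"
      by (simp_all add: algebra_simps)
    then have sum: "(r + c) * h + (r - c) * h = r + r * int m"
      and diff: "(r + c) * h - (r - c) * h = c + c * int m"
      unfolding h by (simp_all only: distrib_left mult_1_right add.commute)
    have "p (pt ((r + c) * h) ((r - c) * h)) = Inl (r mod int m)"
      unfolding p_pt sum by (simp only: mod_mult_self1)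
    moreover have "q (pt ((r + c) * h) ((r - c) * h)) = Inr (c mod int m)"
      unfolding q_pt diff by (simp only: mod_mult_self1)
    moreover have "f (p (pt ((r + c) * h) ((r - c) * h))) = f (q (pt ((r + c) * h) ((r - c) * h)))"
      by (rule all) (rule pt_in_verts)
    ultimately show ?thesis by (simp only:)
  qed
  have "f ` W \<subseteq> {f (Inr 0)}"
  proof -
    have "f (Inl r) = f (Inr 0)" if "r \<in> {0..<int m}" for r
      using gh[of r 0] that by (simp add: mod_pos_pos_trivial)
    moreover have "f (Inr c) = f (Inr 0)" if "c \<in> {0..<int m}" for c
      using gh[of 0 c] gh[of 0 0] that by (simp add: mod_pos_pos_trivial)
    ultimately show ?thesis unfolding W_def Plus_def by blast
  qed
  then have "card (f ` W) \<le> 1" using card_mono[of "{f (Inr 0)}"] by simp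
  then show ?thesis using f cardW by simp
qed

section \<open>Forcing sets of the torus\<close>

context torus_coords
begin

text \<open>
  The vertex \<open>(x, y)\<close> is forced by \<open>(x, y - 1)\<close>; the three points listed are the other neighbours
  of this forcer, and they have to be blue before.
\<close>
lemma skew_zero_forcing_set_if_time:
  fixes t :: "int \<Rightarrow> int \<Rightarrow> int"
  assumes per: "\<And>x y. t (x mod int m) (y mod int n) = t x y"
    and BV: "B \<subseteq> pverts (torus m n)"
    and earlier: "\<And>x y x' y'. pt x y \<notin> B \<Longrightarrow>
      (x', y') \<in> {(x, y - 2), (x + 1, y - 1), (x - 1, y - 1)} \<Longrightarrow>
      pt x' y' \<in> B \<or> 0 \<le> t x' y' \<and> t x' y' < t x y"
  shows "skew_zero_forcing_set (torus m n) B"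
proof -
  define rk where "rk v = nat (t (int (fst v)) (int (snd v)))" for v
  have rk_pt: "rk (pt x y) = nat (t x y)" for x y
    using m3 n3 per by (simp add: rk_def pt_def)
  show ?thesis
  proof (rule skew_zero_forcing_set_if_rank[where rk = rk, OF finite_verts BV])
    fix v assume v: "v \<in> pverts (torus m n) - B"
    then obtain x y where xy: "v = pt x y" using vertE by blast
    have "w \<in> B \<or> w \<in> pverts (torus m n) \<and> rk w < rk v"
      if w: "w \<in> nbh (torus m n) (pt x (y - 1)) - {v}" for w
    proof -
      have "pt x y \<notin> B" using v xy by simp
      note pred = earlier[OF this]
      have pred': "pt x' y' \<in> B \<or> pt x' y' \<in> pverts (torus m n) \<and> rk (pt x' y') < rk v"
        if "(x', y') \<in> {(x, y - 2), (x + 1, y - 1), (x - 1, y - 1)}" for x' y'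
        using pred[OF that] by (simp add: rk_pt xy) arith
      have "w = pt x (y - 2) \<or> w = pt (x + 1) (y - 1) \<or> w = pt (x - 1) (y - 1)"
        using w by (simp add: nbh_pt xy) blast
      then show ?thesis
        using pred'[of x "y - 2"] pred'[of "x + 1" "y - 1"] pred'[of "x - 1" "y - 1"]
        by (elim disjE) simp_all
    qed
    moreover have "v \<in> nbh (torus m n) (pt x (y - 1))" by (simp add: nbh_pt xy)
    ultimately show "\<exists>u \<in> pverts (torus m n). v \<in> nbh (torus m n) u \<and>
        (\<forall>w \<in> nbh (torus m n) u - {v}. w \<in> B \<or> w \<in> pverts (torus m n) \<and> rk w < rk v)"
      using pt_in_verts by blast
  qed
qed

end

text \<open>Two adjacent full columns sweep once around the torus.\<close>
lemma ex_forcing_two_lines: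
  assumes "3 \<le> m" "3 \<le> n"
  shows "\<exists>B. skew_zero_forcing_set (torus m n) B \<and> card B \<le> 2 * m"
proof -
  interpret torus_coords m n by unfold_locales (fact assms)+
  define B where "B = {0..<m} \<times> {0..<2::nat}"
  have B_iff: "pt x y \<in> B \<longleftrightarrow> y mod int n < 2" for x y
    using m3 n3 by (auto simp: B_def pt_def nat_less_iff)
  have "skew_zero_forcing_set (torus m n) B"
  proof (rule skew_zero_forcing_set_if_time[where t = "\<lambda>x y. y mod int n"])
    show "B \<subseteq> pverts (torus m n)" using n3 by (auto simp: B_def pverts_torus)
    fix x y x' y' assume "pt x y \<notin> B"
      and xy': "(x', y') \<in> {(x, y - 2), (x + 1, y - 1), (x - 1, y - 1)}"
    then have y2: "2 \<le> y mod int n" by (simp add: B_iff)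
    obtain k where k: "k = 1 \<or> k = 2" "y' = y - k" using xy' by auto
    have lt: "y mod int n < int n" using n3 by simp
    have "y' mod int n = (y mod int n - k) mod int n" using k by (simp add: mod_diff_left_eq)
    also have "\<dots> = y mod int n - k" using k y2 lt by (intro mod_pos_pos_trivial) auto
    finally have "y' mod int n = y mod int n - k" .
    then show "pt x' y' \<in> B \<or> 0 \<le> y' mod int n \<and> y' mod int n < y mod int n"
      using k y2 by auto
  qed simp
  moreover have "card B \<le> 2 * m" by (simp add: B_def)
  ultimately show ?thesis by blast
qed

text \<open>
  A closed path with one point in each row can also sweep over the torus if it moves by steps of
  length two. For even \<open>m\<close> it is a zigzag between two columns. As \<open>n\<close> is odd, it has to go around
  twice and reaches all points. For odd \<open>m\<close> a zigzag cannot close up, and the path is a staircase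
  that goes around in both directions at once, so it has slope \<open>n / m\<close>; this slope has to be less
  than 1 in order that the diagonal predecessors come earlier.

  The time \<open>t\<close> is the linear function that measures the distance from the line of this slope, scaled
  to be an integer. The lattice of pairs with even sum, modulo the periods that it contains, is a
  copy of the torus, and on it \<open>m * y - \<epsilon> * n * x\<close> is well defined modulo \<open>2 * m * n\<close>. The summand
  \<open>m * n * (x + y)\<close> carries this function over to pairs with odd sum. Each force advances the time
  of a row by \<open>2 * m\<close>, and the initial blue set is a window of this length.
\<close>
lemma ex_forcing_staircase:
  assumes "3 \<le> m" "3 \<le> n" "odd n" "even m \<or> n < m"
  shows "\<exists>B. skew_zero_forcing_set (torus m n) B \<and> card B \<le> m"
proof -
  interpret torus_coords m n by unfold_locales (fact assms)+
  define \<epsilon> :: int where "\<epsilon> = (if even m then 0 else 1)"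
  define M where "M = int m"
  define N where "N = int n"
  have pos: "3 \<le> M" "3 \<le> N" using assms by (auto simp: M_def N_def)
  have slope: "0 \<le> \<epsilon> * N" "\<epsilon> * N < M" using assms by (auto simp: \<epsilon>_def M_def N_def)
  have "even (\<epsilon> - M)" by (simp add: \<epsilon>_def M_def)
  then obtain a where a: "\<epsilon> - M = 2 * a" by (rule evenE)
  obtain h where h: "N + 1 = 2 * h"
    using odd_int_halfE[OF assms(3)] by (metis N_def)
  define raw where "raw x y = M * y - \<epsilon> * N * x + M * N * (x + y)" for x y
  define t where "t x y = raw x y mod (2 * (M * N))" for x y
  have MN: "0 < 2 * (M * N)" using pos by simp
  have t_range: "0 \<le> t x y" "t x y < 2 * (M * N)" for x y using MN by (auto simp: t_def)
  have per: "t (x mod int m) (y mod int n) = t x y" for x y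
  proof -
    define k where "k = x div M"
    define l where "l = y div N"
    have x: "x mod int m = x - M * k" and y: "y mod int n = y - N * l"
      by (simp_all add: k_def l_def M_def N_def minus_mult_div_eq_mod)
    have "raw (x - M * k) (y - N * l) = raw x y + M * N * ((\<epsilon> - M) * k - (N + 1) * l)"
      by (simp add: raw_def algebra_simps)
    also have "\<dots> = raw x y + 2 * (M * N) * (a * k - h * l)"
      unfolding a h by (simp add: algebra_simps)
    finally show ?thesis unfolding t_def x y by simp
  qed
  define B where "B = {v \<in> pverts (torus m n). t (int (fst v)) (int (snd v)) < 2 * M}"
  have B_iff: "pt x y \<in> B \<longleftrightarrow> t x y < 2 * M" for x y
    using per m3 n3 pt_in_verts[of x y] by (simp add: B_def) (simp add: pt_def)
  have "skew_zero_forcing_set (torus m n) B"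
  proof (rule skew_zero_forcing_set_if_time[where t = t, OF per])
    show "B \<subseteq> pverts (torus m n)" by (auto simp: B_def)
    fix x y x' y' assume "pt x y \<notin> B"
      and xy': "(x', y') \<in> {(x, y - 2), (x + 1, y - 1), (x - 1, y - 1)}"
    then have t2: "2 * M \<le> t x y" by (simp add: B_iff)
    have "\<exists>d c. raw x' y' = raw x y - d + 2 * (M * N) * c \<and> 0 < d \<and> d \<le> 2 * M"
    proof -
      have "raw x (y - 2) = raw x y - 2 * M + 2 * (M * N) * (-1)"
        "raw (x + 1) (y - 1) = raw x y - (M + \<epsilon> * N) + 2 * (M * N) * 0"
        "raw (x - 1) (y - 1) = raw x y - (M - \<epsilon> * N) + 2 * (M * N) * (-1)"
        by (simp_all add: raw_def algebra_simps)
      moreover have "0 < 2 * M" "0 < M + \<epsilon> * N" "M + \<epsilon> * N \<le> 2 * M"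
        "0 < M - \<epsilon> * N" "M - \<epsilon> * N \<le> 2 * M" using slope pos by linarith+
      ultimately show ?thesis using xy' by (metis Pair_inject empty_iff insert_iff order_refl)
    qed
    then obtain d c where d: "raw x' y' = raw x y - d + 2 * (M * N) * c" "0 < d" "d \<le> 2 * M"
      by blast
    have "t x' y' = (t x y - d) mod (2 * (M * N))"
      unfolding t_def d(1) by (simp add: mod_diff_left_eq)
    also have "\<dots> = t x y - d"
      using t2 d t_range[of x y] by (intro mod_pos_pos_trivial) auto
    finally show "pt x' y' \<in> B \<or> 0 \<le> t x' y' \<and> t x' y' < t x y"
      using d t2 by simp
  qed
  moreover have "card B \<le> m"
  proof -
    \<comment> \<open>within a row the times are congruent modulo \<open>2 * m\<close>, so only one of them is in the window\<close>
    have "inj_on fst B"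
    proof (rule inj_onI)
      fix v w assume v: "v \<in> B" and w: "w \<in> B" and eq: "fst v = fst w"
      obtain x y where v': "v = (x, y)" by force
      obtain y' where w': "w = (x, y')" using eq v' by (cases w) auto
      have y: "y < n" "y' < n" "t (int x) (int y) < 2 * M" "t (int x) (int y') < 2 * M"
        using v w by (auto simp: v' w' B_def pverts_torus)
      have t_mod: "t x' y' mod (2 * M) = raw x' y' mod (2 * M)" for x' y'
        unfolding t_def by (rule mod_mod_cancel) simp
      have diff: "raw (int x) (int y) - raw (int x) (int y') = 2 * M * (h * (int y - int y'))"
      proof -
        have "raw (int x) (int y) - raw (int x) (int y') = M * (N + 1) * (int y - int y')"
          by (simp add: raw_def algebra_simps)
        then show ?thesis unfolding h by simp
      qed
      then have "raw (int x) (int y) mod (2 * M) = raw (int x) (int y') mod (2 * M)"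
        by (simp add: mod_eq_dvd_iff)
      then have "t (int x) (int y) mod (2 * M) = t (int x) (int y') mod (2 * M)"
        by (simp add: t_mod)
      then have "t (int x) (int y) = t (int x) (int y')" using y t_range by simp
      then have "2 * (M * N) dvd 2 * M * (h * (int y - int y'))"
        unfolding t_def mod_eq_dvd_iff diff .
      then have "2 * M * N dvd 2 * M * (h * (int y - int y'))" by (simp only: mult.assoc)
      then have "N dvd h * (int y - int y')" using pos by (subst (asm) dvd_mult_cancel_left) auto
      then have "N dvd 2 * (h * (int y - int y'))" by (rule dvd_mult)
      then have "N dvd (N + 1) * (int y - int y')" unfolding h by (simp only: mult.assoc)
      then have "N dvd N * (int y - int y') + (int y - int y')" by (simp only: distrib_right mult_1)
      then have "N dvd int y - int y'" by (metis dvd_add_right_iff dvd_triv_left)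
      then have "int y mod N = int y' mod N" by (simp add: mod_eq_dvd_iff)
      then have "y = y'" using y by (simp add: N_def)
      then show "v = w" by (simp add: v' w')
    qed
    moreover have "fst ` B \<subseteq> {0..<m}" by (auto simp: B_def pverts_torus)
    ultimately have "card B \<le> card {0..<m}" by (rule card_inj_on_le) simp
    then show ?thesis by simp
  qed
  ultimately show ?thesis by blast
qed

text \<open>
  The coordinates of \<open>(x, y)\<close> along the two diagonal directions are \<open>co (x + y)\<close> and \<open>co (y - x)\<close>,
  where \<open>co\<close> halves its argument modulo \<open>m\<close>. In these coordinates the forcer of a vertex has as
  neighbours the four corners of a unit square, the forced vertex being its upper right corner. So
  a coordinate cross forces everything, one square after another.
\<close>
lemma ex_forcing_cross:
  assumes "3 \<le> m" "odd m"
  shows "\<exists>B. skew_zero_forcing_set (torus m m) B \<and> card B \<le> 2 * m - 1"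
proof -
  interpret torus_coords m m by unfold_locales (fact assms)+
  obtain h where h: "2 * h = int m + 1" using odd_int_halfE assms(2) .
  define co where "co s = (s * h) mod int m" for s
  have co_range: "0 \<le> co s" "co s < int m" for s using m3 by (auto simp: co_def)
  have co_step: "co (s - 2) = co s - 1" if "co s \<noteq> 0" for s
  proof -
    have "(s - 2) * h = s * h - 2 * h" by (simp add: algebra_simps)
    then have "(s - 2) * h = s * h - 1 - int m" unfolding h by simp
    then have "co (s - 2) = (s * h - 1 - int m) mod int m" by (simp add: co_def)
    also have "\<dots> = (s * h - 1) mod int m" by (rule minus_mod_self2)
    also have "\<dots> = (co s - 1) mod int m" by (simp add: co_def mod_diff_left_eq)
    also have "\<dots> = co s - 1"
      using that co_range[of s] by (intro mod_pos_pos_trivial) auto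
    finally show ?thesis .
  qed
  have co_cong: "co s = co s'" if "s mod int m = s' mod int m" for s s'
    using that unfolding co_def by (metis mod_mult_left_eq)
  have co_0: "int m dvd s" if "co s = 0" for s
  proof -
    have "int m dvd s * h" using that by (auto simp: co_def)
    then have "int m dvd s * (2 * h)" by (metis dvd_mult mult.left_commute)
    then have "int m dvd s * int m + s" by (simp add: h distrib_left)
    then show ?thesis by (metis dvd_add_right_iff dvd_triv_right)
  qed
  define B where "B = {pt x y | x y. co (x + y) = 0 \<or> co (y - x) = 0}"
  have pt_cong: "co (x + y) = co (x' + y')" "co (y - x) = co (y' - x')"
    if "pt x y = pt x' y'" for x y x' y'
    using that by (auto intro!: co_cong simp: pt_eq_iff intro: mod_add_cong mod_diff_cong)
  have B_iff: "pt x y \<in> B \<longleftrightarrow> co (x + y) = 0 \<or> co (y - x) = 0" for x y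
  proof
    assume "pt x y \<in> B"
    then obtain x' y' where "pt x y = pt x' y'" "co (x' + y') = 0 \<or> co (y' - x') = 0"
      unfolding B_def by blast
    then show "co (x + y) = 0 \<or> co (y - x) = 0" using pt_cong by metis
  qed (auto simp: B_def)
  have "skew_zero_forcing_set (torus m m) B"
  proof (rule skew_zero_forcing_set_if_time[where t = "\<lambda>x y. co (x + y) + co (y - x)"])
    show "co (x mod int m + y mod int m) + co (y mod int m - x mod int m) =
        co (x + y) + co (y - x)" for x y
      using pt_cong[of "x mod int m" "y mod int m" x y] by (simp add: pt_eq_iff)
    show "B \<subseteq> pverts (torus m m)" by (auto simp: B_def)
    fix x y x' y' assume "pt x y \<notin> B"
      and xy': "(x', y') \<in> {(x, y - 2), (x + 1, y - 1), (x - 1, y - 1)}"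
    then have ne: "co (x + y) \<noteq> 0" "co (y - x) \<noteq> 0" by (auto simp: B_iff)
    have "(x' + y' = x + y - 2 \<or> x' + y' = x + y) \<and> (y' - x' = y - x - 2 \<or> y' - x' = y - x) \<and>
        (x' + y' = x + y - 2 \<or> y' - x' = y - x - 2)" using xy' by auto
    then have "co (x' + y') + co (y' - x') < co (x + y) + co (y - x)"
      using co_step[OF ne(1)] co_step[OF ne(2)] by (elim conjE disjE) simp_all
    then show "pt x' y' \<in> B \<or> 0 \<le> co (x' + y') + co (y' - x') \<and>
        co (x' + y') + co (y' - x') < co (x + y) + co (y - x)"
      using co_range(1) by (simp add: add_nonneg_nonneg)
  qed
  moreover have "card B \<le> 2 * m - 1"
  proof -
    have "B \<subseteq> (\<lambda>x. pt x (- x)) ` {0..<int m} \<union> (\<lambda>x. pt x x) ` {1..<int m}"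
    proof
      fix v assume "v \<in> B"
      then obtain x y where v: "v = pt x y" "co (x + y) = 0 \<or> co (y - x) = 0"
        by (auto simp: B_def)
      define z where "z = x mod int m"
      have z: "0 \<le> z" "z < int m" "x mod int m = z mod int m" using m3 by (auto simp: z_def)
      from v(2) consider "v = pt z (- z)" | "v = pt z z"
      proof
        assume "co (x + y) = 0"
        then have "y mod int m = (- x) mod int m"
          using co_0[of "x + y"] by (simp add: mod_eq_dvd_iff add.commute)
        then have "v = pt z (- z)"
          by (simp only: v(1) pt_eq_iff z_def mod_mod_trivial mod_minus_eq)
        then show thesis by (rule \<open>v = pt z (- z) \<Longrightarrow> thesis\<close>)
      next
        assume "co (y - x) = 0"
        then have "y mod int m = x mod int m"
          using co_0[of "y - x"] by (simp add: mod_eq_dvd_iff)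
        then have "v = pt z z" by (simp only: v(1) pt_eq_iff z_def mod_mod_trivial)
        then show thesis by (rule \<open>v = pt z z \<Longrightarrow> thesis\<close>)
      qed
      then show "v \<in> (\<lambda>x. pt x (- x)) ` {0..<int m} \<union> (\<lambda>x. pt x x) ` {1..<int m}"
      proof cases
        case 1
        then show ?thesis using z by auto
      next
        case 2
        show ?thesis
        proof (cases "z = 0")
          case True
          then have "v = pt z (- z)" using 2 by simp
          then show ?thesis using z by auto
        next
          case False
          then have "z \<in> {1..<int m}" using z by simp
          then show ?thesis using 2 by blast
        qed
      qed
    qed
    then have "card B \<le> card ((\<lambda>x. pt x (- x)) ` {0..<int m} \<union> (\<lambda>x. pt x x) ` {1..<int m})"
      by (intro card_mono) auto
    also have "\<dots> \<le> card ((\<lambda>x. pt x (- x)) ` {0..<int m}) + card ((\<lambda>x. pt x x) ` {1..<int m})"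
      by (rule card_Un_le)
    also have "\<dots> \<le> card {0..<int m} + card {1..<int m}"
      by (intro add_mono card_image_le) auto
    also have "\<dots> = 2 * m - 1" using m3 by (simp add: nat_diff_distrib)
    finally show ?thesis .
  qed
  ultimately show ?thesis by blast
qed

section \<open>Exchanging the factors\<close>

lemma nbh_cart_prod_swap: "nbh (H \<box> G) (prod.swap u) = prod.swap ` nbh (G \<box> H) u"
  by (auto simp: nbh_def cart_prod_def image_iff)

lemma skew_zero_forcing_set_swap:
  assumes "skew_zero_forcing_set (G \<box> H) B"
  shows "skew_zero_forcing_set (H \<box> G) (prod.swap ` B)"
proof -
  have verts: "prod.swap ` pverts (G \<box> H) = pverts (H \<box> G)" by (auto simp: cart_prod_def)
  have force: "skew_force (H \<box> G) (prod.swap ` S) (prod.swap ` T)"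
    if ST: "skew_force (G \<box> H) S T" for S T
  proof -
    obtain u v where uv: "u \<in> pverts (G \<box> H)" "v \<in> pverts (G \<box> H)" "nbh (G \<box> H) u - S = {v}"
        "T = insert v S" using ST by (auto simp: skew_force_def)
    have "nbh (H \<box> G) (prod.swap u) - prod.swap ` S = prod.swap ` (nbh (G \<box> H) u - S)"
      by (simp add: nbh_cart_prod_swap image_set_diff)
    then have "nbh (H \<box> G) (prod.swap u) - prod.swap ` S = {prod.swap v}" using uv by simp
    moreover have "prod.swap u \<in> pverts (H \<box> G)" "prod.swap v \<in> pverts (H \<box> G)"
      using uv verts by blast+
    moreover have "prod.swap ` T = insert (prod.swap v) (prod.swap ` S)" using uv by simp
    ultimately show ?thesis unfolding skew_force_def by blast
  qed
  have "(skew_force (H \<box> G))\<^sup>*\<^sup>* (prod.swap ` B) (prod.swap ` S)"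
    if "(skew_force (G \<box> H))\<^sup>*\<^sup>* B S" for S
    using that by (induction rule: rtranclp_induct) (auto dest: force intro: rtranclp.rtrancl_into_rtrancl)
  then show ?thesis
    using assms verts unfolding skew_zero_forcing_set_def by (metis image_mono)
qed

lemma card_swap_image: "card (prod.swap ` B) = card B"
  by (rule card_image) simp

section \<open>The two invariants of the torus\<close>

lemma skew_zero_forcing_number_torus:
  assumes "3 \<le> a" "a \<le> b"
  shows "skew_zero_forcing_number (torus a b) = rho a b"
proof -
  have b3: "3 \<le> b" using assms by simp
  have fin: "finite (pverts (torus a b))" by (simp add: pverts_torus)
  have sw: "\<exists>B. skew_zero_forcing_set (torus a b) B \<and> card B \<le> r"
    if "\<exists>B. skew_zero_forcing_set (torus b a) B \<and> card B \<le> r" for r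
    using that skew_zero_forcing_set_swap card_swap_image by metis
  have "\<exists>B. skew_zero_forcing_set (torus a b) B \<and> card B \<le> rho a b"
  proof -
    consider "a = b" "odd a" | "rho a b = 2 * a" | "a \<noteq> b" "odd a" "rho a b = b"
      | "even a" "odd b" "rho a b = a"
    proof (cases "a = b \<or> (odd a \<longrightarrow> 2 * a < b) \<and> (even a \<longrightarrow> even b)")
      case True
      then show thesis using that(1,2) by (cases "a = b"; cases "odd a") (auto simp: rho_def)
    next
      case False
      then show thesis using that(3,4) by (cases "odd a") (auto simp: rho_def)
    qed
    then show ?thesis
    proof cases
      case 1
      then show ?thesis using ex_forcing_cross[of a] assms by (simp add: rho_def)
    next
      case 2
      then show ?thesis using ex_forcing_two_lines[OF assms(1) b3] by simp
    next
      case 3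
      then show ?thesis using ex_forcing_staircase[of b a] sw assms b3 by simp
    next
      case 4
      then show ?thesis using ex_forcing_staircase[of a b] assms b3 by simp
    qed
  qed
  then obtain B where B: "skew_zero_forcing_set (torus a b) B" "card B \<le> rho a b" by blast
  have "rho a b \<le> card B'" if B': "skew_zero_forcing_set (torus a b) B'" for B'
  proof -
    consider "a = b" "odd a" | "a \<noteq> b" "odd a" | "even a" "odd b" | "even a" "even b" by auto
    then show ?thesis
    proof cases
      case 1
      then show ?thesis using le_card_forcing_odd_square[of a B'] B' assms by (simp add: rho_def)
    next
      case 2
      then show ?thesis using min_le_card_forcing_odd[OF assms(1) b3 _ B'] by (simp add: rho_def)
    next
      case 3
      then show ?thesis
        using min_le_card_forcing_odd[OF b3 assms(1) _ skew_zero_forcing_set_swap[OF B']] assms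
        by (auto simp: rho_def card_swap_image)
    next
      case 4
      then show ?thesis
        using min_le_card_forcing_even[OF assms(1) b3 _ _ B'] assms
        by (auto simp: rho_def min_def)
    qed
  qed
  then show ?thesis by (rule skew_zero_forcing_number_eqI[OF fin B])
qed

theorem theorem1p3:
  fixes a b :: nat
  assumes "3 \<le> a" and "a \<le> b"
  shows "skew_zero_forcing_number (cycle_graph a \<box> cycle_graph b) = rho a b \<and>
    grundy_total_domination_number (cycle_graph a \<box> cycle_graph b) = a * b - rho a b"
proof -
  have "card (pverts (torus a b)) = a * b" "finite (pverts (torus a b))"
    by (simp_all add: pverts_torus)
  then show ?thesis
    using skew_zero_forcing_number_torus[OF assms]
      grundy_total_domination_number_eq[of "torus a b"] nbh_torus_subset by simp
qed

end
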